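(* Let $n$, $k$ and $\ell$ be integers with $k\geq \ell\geq 1$ and $n\geq \ell+2$. Let $G$ be an $n$-vertex graph such that there is a labelling $v_1,\ldots,v_n$ of $V(G)$ with the following two properties: (i) for every edge $v_iv_j\in E(G)$ we have $|i-j|\leq k$; (ii) for every $i\in[n]$, \[ \deg_G(v_i)\geq \min\{\,k+\ell,\ \min\{i-1,k\}+\min\{n-i,k\}\,\}. \] Then $G$ contains a spanning subdivision of $K_{2,\ell}$ rooted at $v_1$ and $v_n$, i.e.\ there exist $\ell$ paths in $G$, each from $v_1$ to $v_n$ and each with at least two edges, which pairwise share no vertices other than $v_1$ and $v_n$, and whose union covers all vertices of $G$.
   Context: Condition (i) says that the labelling is an embedding of $G$ into $P_n^k$, the $k$-th power of the path $v_1\cdots v_n$ (where $v_i,v_j$ are adjacent iff $1\le |i-j|\le k$), so $G$ has bandwidth at most $k$; the quantity $\min\{i-1,k\}+\min\{n-i,k\}$ is the degree of the $i$-th vertex of $P_n^k$. The paper abbreviates (i) and (ii) as $\delta^k_{\mathrm{eff}}(G)\ge k+\ell$ (effective minimum degree). A subdivision of a graph $H$ is obtained by replacing each edge of $H$ by a path of positive length, all such paths internally disjoint; a subdivision of $K_{2,\ell}$ rooted at $u,v$ is one in which the two vertices of the part of size $2$ of $K_{2,\ell}$ are $u$ and $v$. *)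

theory Defs
  imports "Graph_Theory.Graph_Theory"
begin

text \<open>
  A finite simple graph is a \<open>pair_graph\<close>: a finite, loop-free, symmetric digraph whose arcs are
  ordered pairs, so that an edge \<open>xy\<close> is the pair of arcs \<open>(x, y)\<close>, \<open>(y, x)\<close>. The degree of a
  vertex is then its out-degree.
\<close>

definition K2_rooted :: "'a \<Rightarrow> 'a \<Rightarrow> 'a set \<Rightarrow> 'a pair_pre_digraph" where
  "K2_rooted u v W = \<lparr> pverts = {u, v} \<union> W, parcs = {u, v} \<times> W \<union> W \<times> {u, v} \<rparr>"

text \<open>
  The library's subdivision keeps the vertices of the subdivided graph, so the two roots
  of \<open>K\<^sub>2\<^sub>,\<^sub>l\<close> are \<open>u\<close> and \<open>v\<close> themselves, and the other branch vertices are the elements of \<open>W\<close>.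
\<close>

definition has_spanning_K2_subdivision :: "'a pair_pre_digraph \<Rightarrow> nat \<Rightarrow> 'a \<Rightarrow> 'a \<Rightarrow> bool" where
  "has_spanning_K2_subdivision G l u v \<longleftrightarrow>
     (\<exists>W S. u \<noteq> v \<and> u \<notin> W \<and> v \<notin> W \<and> finite W \<and> card W = l \<and>
        subdivision_pair (K2_rooted u v W) S \<and> spanning (with_proj S) (with_proj G))"

definition has_spanning_path_system :: "'a pair_pre_digraph \<Rightarrow> nat \<Rightarrow> 'a \<Rightarrow> 'a \<Rightarrow> bool" where
  "has_spanning_path_system G l u v \<longleftrightarrow>
     (\<exists>P :: nat \<Rightarrow> 'a list.
        (\<forall>i<l. vpath (P i) (with_proj G) \<and> hd (P i) = u \<and> last (P i) = v \<and>
               vwalk_length (P i) \<ge> 2) \<and>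
        (\<forall>i<l. \<forall>j<l. i \<noteq> j \<longrightarrow> set (P i) \<inter> set (P j) \<subseteq> {u, v}) \<and>
        (\<Union>i<l. set (P i)) = pverts G)"

lemma complete_bipartite_K2_rooted:
  assumes "u \<noteq> v" "u \<notin> W" "v \<notin> W" "finite W"
  shows "K\<^bsub>2,card W\<^esub> (with_proj (K2_rooted u v W))"
  unfolding complete_bipartite_digraph_pair_def
proof (intro conjI exI)
  show "card {u, v} = 2" "card W = card W" using assms by simp_all
qed (use assms in \<open>auto simp: K2_rooted_def\<close>)

text \<open>
  The graph formed by the paths from \<open>u\<close> to \<open>v\<close> whose lists of inner vertices are \<open>Q 0, \<dots>, Q (l - 1)\<close>;
  it serves only to derive the subdivision from the path system.
\<close>

definition path_system_graph :: "nat \<Rightarrow> 'a \<Rightarrow> 'a \<Rightarrow> (nat \<Rightarrow> 'a list) \<Rightarrow> 'a pair_pre_digraph" where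
  "path_system_graph l u v Q = \<lparr> pverts = {u,v} \<union> (\<Union>i<l. set (Q i)),
     parcs = (\<Union>i<l. let A = set (vwalk_arcs (u # Q i @ [v])) in A \<union> A\<inverse>) \<rparr>"

lemma vwalk_arcs_subset: "set (vwalk_arcs p) \<subseteq> set p \<times> set p"
  by (induct p rule: vwalk_arcs.induct) auto

lemma subdivision_path_system_graph:
  assumes "u \<noteq> v"
  shows "\<lbrakk>\<forall>i<l. Q i \<noteq> [] \<and> distinct (Q i) \<and> u \<notin> set (Q i) \<and> v \<notin> set (Q i);
     \<forall>i<l. \<forall>j<l. i \<noteq> j \<longrightarrow> set (Q i) \<inter> set (Q j) = {}\<rbrakk> \<Longrightarrow>
     subdivision_pair (K2_rooted u v ((\<lambda>i. last (Q i)) ` {..<l})) (path_system_graph l u v Q)"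
proof (induction "\<Sum>i<l. length (Q i)" arbitrary: Q rule: less_induct)
  case less
  show ?case
  proof (cases "\<exists>i<l. length (Q i) \<ge> 2")
    case False
    have sing: "Q i = [last (Q i)]" if "i < l" for i
      using False less.prems(1) that by (cases "Q i"; cases "tl (Q i)") (auto simp: Suc_le_eq not_le)
    have ss: "set (Q i) = {last (Q i)}" if "i < l" for i
      using arg_cong[OF sing[OF that], of set] by (simp only: set_simps)
    have sv: "set (vwalk_arcs (u # Q i @ [v])) = {(u, last (Q i)), (last (Q i), v)}" if "i < l" for i
      using sing[OF that] by (metis append_Cons append_Nil vwalk_arcs.simps(2,3) list.simps(15) empty_set)
    let ?W = "(\<lambda>i. last (Q i)) ` {..<l}"
    have eq: "path_system_graph l u v Q = K2_rooted u v ?W"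
      unfolding path_system_graph_def K2_rooted_def using ss sv
      by (auto simp: Let_def)
    have nW: "u \<notin> ?W" "v \<notin> ?W"
      using less.prems(1) by (metis (no_types, lifting) imageE last_in_set lessThan_iff)+
    have "K\<^bsub>2,card ?W\<^esub> (with_proj (K2_rooted u v ?W))"
      by (rule complete_bipartite_K2_rooted) (use nW assms in auto)
    then have "pair_graph (K2_rooted u v ?W)" by (rule pair_graphI_complete_bipartite)
    then interpret pair_graph "K2_rooted u v ?W" .
    show ?thesis unfolding eq by (rule subdivision_pair_base) unfold_locales
  next
    case True
    then obtain i where i: "i < l" "length (Q i) \<ge> 2" by auto
    then obtain a b r where Qi: "Q i = a # b # r"
      by (cases "Q i"; cases "tl (Q i)") auto
    define Q' where "Q' = Q(i := b # r)"
    have less': "(\<Sum>i<l. length (Q' i)) < (\<Sum>i<l. length (Q i))"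
      by (rule sum_strict_mono_ex1) (use i Qi in \<open>auto simp: Q'_def\<close>)
    have p1: "\<forall>i<l. Q' i \<noteq> [] \<and> distinct (Q' i) \<and> u \<notin> set (Q' i) \<and> v \<notin> set (Q' i)"
      using less.prems(1) i Qi by (auto simp: Q'_def)
    have sub: "set (Q' j) \<subseteq> set (Q j)" for j using Qi by (auto simp: Q'_def)
    have p2: "\<forall>i<l. \<forall>j<l. i \<noteq> j \<longrightarrow> set (Q' i) \<inter> set (Q' j) = {}"
      using less.prems(2) sub by blast
    have lasteq: "last (Q' j) = last (Q j)" for j using Qi by (auto simp: Q'_def)
    have IH: "subdivision_pair (K2_rooted u v ((\<lambda>i. last (Q i)) ` {..<l})) (path_system_graph l u v Q')"
      using less.hyps[OF less' p1 p2] unfolding lasteq .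
    define R where "R = (\<Union>j\<in>{..<l}-{i}. let A = set (vwalk_arcs (u # Q j @ [v])) in A \<union> A\<inverse>)"
    define C where "C = set (vwalk_arcs (b # r @ [v]))"
    define f where "f Q j = (let A = set (vwalk_arcs (u # Q j @ [v])) in A \<union> A\<inverse>)" for Q :: "nat \<Rightarrow> 'a list" and j
    have U: "(\<Union>j<l. F j) = F i \<union> (\<Union>j\<in>{..<l}-{i}. F j)" for F :: "nat \<Rightarrow> 'c set" using i by auto
    have pf: "parcs (path_system_graph l u v Q) = (\<Union>j<l. f Q j)" for Q by (simp add: path_system_graph_def f_def)
    have fi: "f Q i = {(u,a),(a,u),(a,b),(b,a)} \<union> C \<union> C\<inverse>" "f Q' i = {(u,b),(b,u)} \<union> C \<union> C\<inverse>"
      by (auto simp: f_def Q'_def Qi C_def Let_def)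
    have fj: "(\<Union>j\<in>{..<l}-{i}. f Q j) = R" "(\<Union>j\<in>{..<l}-{i}. f Q' j) = R"
      by (simp_all add: f_def Q'_def R_def)
    have anb: "a \<noteq> b" "a \<notin> set r" "a \<noteq> u" "a \<noteq> v" "b \<noteq> u" "b \<noteq> v" "u \<notin> set r"
      using less.prems(1) i Qi by (metis distinct.simps(2) list.set_intros set_ConsD)+
    have dis: "a \<notin> set (Q j)" "b \<notin> set (Q j)" if "j < l" "j \<noteq> i" for j
      using less.prems(2) i that Qi by (metis disjoint_iff list.set_intros)+
    have arcsQ: "parcs (path_system_graph l u v Q) = {(u,a),(a,u),(a,b),(b,a)} \<union> C \<union> C\<inverse> \<union> R"
      unfolding pf by (subst U) (simp only: fi fj)
    have arcsQ': "parcs (path_system_graph l u v Q') = {(u,b),(b,u)} \<union> C \<union> C\<inverse> \<union> R"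
      unfolding pf by (subst U) (simp only: fi fj)
    have C: "(u,b) \<notin> C" "(b,u) \<notin> C"
      using vwalk_arcs_subset[of "b # r @ [v]"] anb assms unfolding C_def by auto
    have R: "(u,b) \<notin> R" "(b,u) \<notin> R"
    proof -
      have *: "x \<in> insert u (insert v (set (Q j)))" "y \<in> insert u (insert v (set (Q j)))"
        if "(x,y) \<in> set (vwalk_arcs (u # Q j @ [v]))" for x y j
        using subsetD[OF vwalk_arcs_subset that] by auto
      have "\<exists>j<l. j \<noteq> i \<and> x \<in> insert u (insert v (set (Q j))) \<and> y \<in> insert u (insert v (set (Q j)))"
        if "(x,y) \<in> R" for x y
        using that * unfolding R_def Let_def by (fastforce simp del: vwalk_arcs.simps)
      then show "(u,b) \<notin> R" "(b,u) \<notin> R" using dis anb by (metis insertE)+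
    qed
    have vs: "(\<Union>j\<in>{..<l}-{i}. set (Q' j)) = (\<Union>j\<in>{..<l}-{i}. set (Q j))" by (simp add: Q'_def)
    have "(\<Union>j<l. set (Q j)) = insert a (\<Union>j<l. set (Q' j))"
      unfolding U[of "\<lambda>j. set (Q j)"] U[of "\<lambda>j. set (Q' j)"] vs by (simp add: Qi Q'_def)
    then have vertsQ: "pverts (path_system_graph l u v Q) = insert a (pverts (path_system_graph l u v Q'))"
      unfolding path_system_graph_def by auto
    have aQ': "a \<notin> pverts (path_system_graph l u v Q')"
      unfolding path_system_graph_def using dis anb i by (auto simp: Q'_def)
    have "path_system_graph l u v Q = subdivide (path_system_graph l u v Q') (u,b) a"
    proof (rule pair_pre_digraph.equality)
      show "parcs (path_system_graph l u v Q) = parcs (subdivide (path_system_graph l u v Q') (u,b) a)"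
        unfolding arcs_subdivide arcsQ arcsQ' using C R anb by auto
    qed (simp_all add: vertsQ)
    moreover have "(u,b) \<in> parcs (path_system_graph l u v Q')" unfolding arcsQ' by simp
    ultimately show ?thesis using subdivision_pair_divide[OF _ aQ' IH] by (simp only:)
  qed
qed

lemma has_spanning_K2_subdivision_if_path_system:
  assumes G: "pair_graph G" and "l \<ge> 1" "u \<noteq> v" "has_spanning_path_system G l u v"
  shows "has_spanning_K2_subdivision G l u v"
proof -
  interpret pair_graph G by fact
  obtain P where P: "\<forall>i<l. vpath (P i) (with_proj G) \<and> hd (P i) = u \<and> last (P i) = v \<and> vwalk_length (P i) \<ge> 2"
    "\<forall>i<l. \<forall>j<l. i \<noteq> j \<longrightarrow> set (P i) \<inter> set (P j) \<subseteq> {u, v}"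
    "(\<Union>i<l. set (P i)) = pverts G"
    using assms unfolding has_spanning_path_system_def by auto
  define Q where "Q i = butlast (tl (P i))" for i
  have PQ: "P i = u # Q i @ [v]" "Q i \<noteq> []" if "i < l" for i
  proof -
    have *: "hd (P i) = u" "last (P i) = v" "length (P i) \<ge> 3" using P(1) that by auto
    then obtain x t where 0: "P i = x # t" by (cases "P i") auto
    with * have 1: "P i = x # t" "t \<noteq> []" by auto
    then have "t = Q i @ [v]" using * append_butlast_last_id[of t] by (simp add: Q_def)
    moreover have "t = Q i @ [v] \<Longrightarrow> Q i \<noteq> []" using * 1 by auto
    ultimately have "t = Q i @ [v]" "Q i \<noteq> []" by blast+
    with 1 * show "P i = u # Q i @ [v]" "Q i \<noteq> []" by auto
  qed
  have q1: "\<forall>i<l. Q i \<noteq> [] \<and> distinct (Q i) \<and> u \<notin> set (Q i) \<and> v \<notin> set (Q i)"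
  proof (intro allI impI)
    fix i assume "i < l"
    then have "distinct (P i)" using P(1) by (simp add: vpath_def)
    then have "distinct (u # Q i @ [v])" unfolding PQ(1)[OF \<open>i < l\<close>] .
    then show "Q i \<noteq> [] \<and> distinct (Q i) \<and> u \<notin> set (Q i) \<and> v \<notin> set (Q i)" using PQ \<open>i < l\<close> by auto
  qed
  have q2: "\<forall>i<l. \<forall>j<l. i \<noteq> j \<longrightarrow> set (Q i) \<inter> set (Q j) = {}"
  proof (intro allI impI)
    fix i j assume ij: "i < l" "j < l" "i \<noteq> j"
    then have "set (P i) \<inter> set (P j) \<subseteq> {u,v}" using P(2) by blast
    then have "set (u # Q i @ [v]) \<inter> set (u # Q j @ [v]) \<subseteq> {u,v}"
      unfolding PQ(1)[OF ij(1)] PQ(1)[OF ij(2)] .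
    then show "set (Q i) \<inter> set (Q j) = {}" using q1 ij by auto
  qed
  let ?W = "(\<lambda>i. last (Q i)) ` {..<l}"
  have inj: "inj_on (\<lambda>i. last (Q i)) {..<l}"
    using q1 q2 by (intro inj_onI) (metis disjoint_iff last_in_set lessThan_iff)
  have nW: "u \<notin> ?W" "v \<notin> ?W"
    using q1 by (metis (no_types, lifting) imageE last_in_set lessThan_iff)+
  have sd: "subdivision_pair (K2_rooted u v ?W) (path_system_graph l u v Q)"
    by (rule subdivision_path_system_graph[OF assms(3) q1 q2])
  have vG: "pverts (path_system_graph l u v Q) = pverts G"
  proof -
    have e: "set (P i) = {u,v} \<union> set (Q i)" if "i < l" for i unfolding PQ(1)[OF that] by auto
    have "0 < l" using \<open>l \<ge> 1\<close> by simp
    then show ?thesis unfolding P(3)[symmetric] path_system_graph_def by (auto simp: e)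
  qed
  have arcs_sub: "set (vwalk_arcs (u # Q i @ [v])) \<subseteq> parcs G" if "i < l" for i
  proof -
    have "vwalk (P i) (with_proj G)" using P(1) that by (simp add: vpath_def)
    then show ?thesis unfolding PQ(1)[OF that] by (simp only: vwalk_def with_proj_simps)
  qed
  have symG: "(y,x) \<in> parcs G" if "(x,y) \<in> parcs G" for x y
    using sym_arcs that by (auto simp: symmetric_def sym_def)
  have aG: "parcs (path_system_graph l u v Q) \<subseteq> parcs G"
    unfolding path_system_graph_def Let_def using subsetD[OF arcs_sub] symG by (auto simp del: vwalk_arcs.simps)
  interpret S: pair_bidirected_digraph "path_system_graph l u v Q"
    using sd by (rule bidirected_digraphI_subdivision)
  have "spanning (with_proj (path_system_graph l u v Q)) (with_proj G)"
    unfolding spanning_def subgraph_def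
    using vG aG S.wf_digraph wf_digraph by auto
  then show ?thesis unfolding has_spanning_K2_subdivision_def
    using sd nW assms(3) card_image[OF inj]
    by (intro exI[of _ ?W] exI[of _ "path_system_graph l u v Q"]) auto
qed

end

theory Submission
  imports Defs "HOL-Library.Multiset"
begin

text \<open>
  Identify the vertices with \<open>1, \<dots>, n\<close> and process them in increasing order, starting with the
  \<open>l\<close> legs \<open>1, j\<close> for \<open>2 \<le> j \<le> l + 1\<close>. At any time the processed vertices are covered by \<open>l\<close> legs
  (paths leaving \<open>1\<close>) and some free paths. A new vertex \<open>y\<close> is joined to the smallest end of a path
  adjacent to it, and then to the smallest further end for which this neither closes a cycle nor
  joins two legs. If \<open>y\<close> passes over a neighbour \<open>x\<close> that is still an end, then it
  consumes ends smaller than \<open>x\<close>; the potential of \<open>x\<close> measures how often this can happen. When \<open>x\<close>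
  is processed, all current ends lie within distance \<open>k\<close>, so the potential is at most \<open>l\<close> plus the
  number \<open>m\<close> of non-neighbours of \<open>x\<close> among the \<open>k\<close> vertices before it. The degree condition gives \<open>x\<close>
  at least \<open>l + m\<close> neighbours among the \<open>k\<close> vertices after it, so \<open>x\<close> stops being an end within \<open>k\<close>
  steps. The same count at time \<open>n - 1\<close> shows that no free path is left, and \<open>n\<close> is
  adjacent to the ends of all legs.
\<close>

section \<open>Partial path systems and the potential of an end\<close>

definition open_ends :: "nat list multiset \<Rightarrow> nat list multiset \<Rightarrow> nat set" where
  "open_ends L F = last ` set_mset L \<union> hd ` set_mset F \<union> last ` set_mset F"

text \<open>
  Legs are stored without the vertex 1. The equation of multisets says at once that the paths are
  disjoint, that they do not repeat vertices, and that they cover \<open>{2..m}\<close>.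
\<close>

definition partial_system ::
    "(nat \<Rightarrow> nat \<Rightarrow> bool) \<Rightarrow> nat \<Rightarrow> nat list multiset \<Rightarrow> nat list multiset \<Rightarrow> bool" where
  "partial_system A m L F \<longleftrightarrow>
     (\<forall>p\<in>#L + F. p \<noteq> [] \<and> successively A p) \<and> (\<forall>p\<in>#L. A 1 (hd p)) \<and>
     (\<Sum>p\<in>#L + F. mset p) = mset_set {2..m}"

text \<open>
  A singleton free path \<open>[x]\<close> has weight 2 at \<open>x\<close>, since \<open>x\<close> still needs two neighbours.
\<close>

definition free_weight :: "nat \<Rightarrow> nat list \<Rightarrow> nat" where
  "free_weight x q = of_bool (hd q < x \<or> last q < x) + of_bool (hd q = x) + of_bool (last q = x)"

text \<open>
  While \<open>x\<close> is not the end of a leg, the constant \<open>size L - 1\<close> replaces the count of the other legs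
  with a smaller end: only after \<open>x\<close> has become the end of a leg can extending one of those legs
  alone pass over \<open>x\<close>.
\<close>

definition leg_weight :: "nat list multiset \<Rightarrow> nat \<Rightarrow> nat" where
  "leg_weight L x =
     (if x \<in> last ` set_mset L then size {#p \<in># L. last p \<le> x#} else size L - 1)"

text \<open>A free path counts once even if both its ends lie below \<open>x\<close>: when a
  neighbour of \<open>x\<close> passes over \<open>x\<close> as an end of some other path, either
  two paths are merged or a leg end moves above \<open>x\<close>.\<close>

definition potential :: "nat list multiset \<Rightarrow> nat list multiset \<Rightarrow> nat \<Rightarrow> nat" where
  "potential L F x = (\<Sum>q\<in>#F. free_weight x q) + leg_weight L x"

section \<open>Change of the potential under the four kinds of joins\<close>

lemma free_weight_rev [simp]: "free_weight x (rev q) = free_weight x q"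
  by (cases "q = []") (auto simp: free_weight_def hd_rev last_rev)

text \<open>The gain for a neighbour \<open>x\<close> of \<open>y\<close> is that the end of
  \<open>p\<close>, counted at \<open>x\<close> before, moves beyond \<open>x\<close>. The last
  premise excludes free ends, for which \<open>leg_weight\<close> is constant.\<close>

lemma potential_join_leg:
  assumes "x < y" "last p' = y" "x \<noteq> last p"
    and "A x y \<Longrightarrow> x \<in> last ` set_mset L \<and> last p \<le> x"
  shows "of_bool (A x y) + potential (add_mset p' L) F x \<le> potential (add_mset p L) F x"
  using assms by (auto simp: potential_def leg_weight_def)

text \<open>For \<open>x = hd q\<close> the smaller end \<open>last q\<close> is lost, or one of the
  two units if the path is a singleton; for \<open>x = last q\<close> the unit of that end is
  lost.\<close>

lemma potential_join_free:
  assumes "x < y" "last q' = y" "hd q' = hd q"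
    and "A x y \<Longrightarrow> last q \<le> x \<and> (x = hd q \<or> x = last q)"
  shows "of_bool (A x y) + potential L (add_mset q' F) x \<le> potential L (add_mset q F) x"
  using assms by (auto simp: potential_def free_weight_def)

text \<open>If \<open>x\<close> ends another leg, \<open>p\<close> gives the gain, and
  \<open>free_weight x q\<close> pays for the new leg end \<open>last q\<close> if that is at most
  \<open>x\<close>. Otherwise \<open>q\<close> gives the gain; if \<open>x = last q\<close> becomes
  a leg end, \<open>leg_weight\<close> may grow by one, which \<open>free_weight x q\<close> covers,
  with one to spare when \<open>hd q \<le> x\<close>.\<close>

lemma potential_join_leg_free:
  assumes "last p' = last q" "x \<noteq> last p"
    and "A x y \<Longrightarrow> x \<in> last ` set_mset L \<Longrightarrow> last p \<le> x"
    and "A x y \<Longrightarrow> x \<notin> last ` set_mset L \<Longrightarrow> hd q \<le> x"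
  shows "of_bool (A x y) + potential (add_mset p' L) F x \<le> potential (add_mset p L) (add_mset q F) x"
proof -
  have "size {#p \<in># L. last p \<le> x#} \<le> size L"
    by (simp add: size_filter_mset_lesseq)
  then show ?thesis
    using assms
    by (cases "A x y"; cases "x \<in> last ` set_mset L")
      (simp_all add: potential_def leg_weight_def free_weight_def of_bool_def
        le_SucI[OF size_filter_mset_lesseq])
qed

text \<open>If \<open>x\<close> is not an end of \<open>q1\<close>, both paths count at
  \<open>x\<close> and merging loses one of these counts. If it is, the loss comes from the joined
  end \<open>last q1\<close>.\<close>

lemma potential_join_free_free:
  assumes "hd q = hd q1" "last q = last q2"
    and "A x y \<Longrightarrow> last q1 \<le> x"
    and "A x y \<Longrightarrow> x = hd q1 \<or> x = last q1 \<or> hd q2 \<le> x"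
  shows "of_bool (A x y) + potential L (add_mset q F) x
    \<le> potential L (add_mset q1 (add_mset q2 F)) x"
  using assms by (cases "A x y") (auto simp: potential_def free_weight_def)

lemma potential_pos:
  assumes "x \<in> open_ends L F"
  shows "potential L F x \<ge> 1"
proof (cases "x \<in> last ` set_mset L")
  case True
  then obtain p where "p \<in># L" "last p = x" by auto
  then have "p \<in># {#p \<in># L. last p \<le> x#}" by simp
  then have "size {#p \<in># L. last p \<le> x#} \<ge> 1"
    by (metis One_nat_def Suc_leI empty_iff nonempty_has_size set_mset_empty)
  then show ?thesis using True by (simp add: potential_def leg_weight_def)
next
  case False
  then obtain q where q: "q \<in># F" "x = hd q \<or> x = last q"
    using assms by (auto simp: open_ends_def)
  then have "free_weight x q \<ge> 1" by (auto simp: free_weight_def)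
  then show ?thesis using q(1) by (auto simp: potential_def dest!: multi_member_split)
qed

lemma sum_free_weight_if_less:
  assumes "\<forall>q\<in>#F. hd q < y \<and> last q < y"
  shows "(\<Sum>q\<in>#F. free_weight y q) = size F"
  using assms by (induction F) (auto simp: free_weight_def)

section \<open>Ends as distinct vertices, and disjointness\<close>

text \<open>A submultiset of \<open>mset_set B\<close> has no repetitions. This turns a number of
  paths into a number of vertices.\<close>

lemma size_le_card_if_subseteq_mset_set:
  assumes "X \<subseteq># mset_set B" "set_mset X \<subseteq> C" "finite C"
  shows "size X \<le> card C"
proof -
  have "count X e \<le> 1" for e
    using mset_subset_eq_count[OF assms(1), of e] by (cases "finite B"; cases "e \<in> B") auto
  then have "size X \<le> (\<Sum>e\<in>set_mset X. 1)"
    unfolding size_multiset_overloaded_eq by (intro sum_mono) auto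
  also have "\<dots> \<le> card C" using assms by (simp add: card_mono)
  finally show ?thesis .
qed

lemma image_hd_subseteq_sum_mset:
  assumes "\<forall>p\<in>#F. p \<noteq> []"
  shows "image_mset hd F \<subseteq># (\<Sum>p\<in>#F. mset p)"
  using assms
proof (induction F)
  case (add p F)
  then have "{#hd p#} + image_mset hd F \<subseteq># mset p + (\<Sum>p\<in>#F. mset p)"
    by (intro subset_mset.add_mono) auto
  then show ?case by simp
qed simp

lemma image_last_subseteq_sum_mset:
  assumes "\<forall>p\<in>#F. p \<noteq> []"
  shows "image_mset last F \<subseteq># (\<Sum>p\<in>#F. mset p)"
  using assms
proof (induction F)
  case (add p F)
  then have "{#last p#} + image_mset last F \<subseteq># mset p + (\<Sum>p\<in>#F. mset p)"
    by (intro subset_mset.add_mono) auto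
  then show ?case by simp
qed simp

text \<open>One end is taken per path, so that a singleton path is not counted twice. The number of
  paths is then bounded by the number of vertices available as ends.\<close>

lemma partial_system_ends_subseteq:
  assumes "partial_system A m L F"
  shows "image_mset hd F + image_mset last L \<subseteq># mset_set {2..m}"
proof -
  have "image_mset hd F + image_mset last L \<subseteq># (\<Sum>p\<in>#F. mset p) + (\<Sum>p\<in>#L. mset p)"
    using assms unfolding partial_system_def
    by (intro subset_mset.add_mono image_hd_subseteq_sum_mset image_last_subseteq_sum_mset) auto
  also have "\<dots> = mset_set {2..m}"
    using assms unfolding partial_system_def by (simp add: add.commute)
  finally show ?thesis .
qed

text \<open>A common element would have multiplicity at least two in the sum.\<close>

lemma disjoint_if_sum_mset_eq_mset_set:
  assumes "(\<Sum>r\<in>#add_mset p X. mset r) = mset_set B" "q \<in># X"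
  shows "set p \<inter> set q = {}"
proof (rule ccontr)
  assume "set p \<inter> set q \<noteq> {}"
  then obtain e where e: "e \<in> set p" "e \<in> set q" by auto
  obtain Y where "X = add_mset q Y" using assms(2) by (metis multi_member_split)
  then have "mset_set B = (mset p + mset q) + (\<Sum>r\<in>#Y. mset r)"
    using assms(1) by (simp add: add.assoc)
  then have "mset p + mset q \<subseteq># mset_set B" by simp
  then have "count (mset p) e + count (mset q) e \<le> count (mset_set B) e"
    by (metis count_union mset_subset_eq_count)
  moreover have "count (mset p) e \<ge> 1" "count (mset q) e \<ge> 1"
    using e by (simp_all add: Suc_le_eq count_greater_zero_iff)
  moreover have "count (mset_set B) e \<le> 1" by (cases "finite B"; cases "e \<in> B") auto
  ultimately show False by linarith
qed

lemma partial_system_leg_disjoint: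
  assumes "partial_system A m (add_mset p L) F"
  shows "set p \<inter> open_ends L F = {}"
proof -
  have "set p \<inter> set q = {} \<and> q \<noteq> []" if "q \<in># L + F" for q
    using disjoint_if_sum_mset_eq_mset_set[of p "L + F" "{2..m}" q] assms that
    unfolding partial_system_def by auto
  then show ?thesis unfolding open_ends_def by (fastforce dest: hd_in_set last_in_set)
qed

lemma partial_system_free_disjoint:
  assumes "partial_system A m L (add_mset p F)"
  shows "set p \<inter> open_ends L F = {}"
proof -
  have "set p \<inter> set q = {} \<and> q \<noteq> []" if "q \<in># L + F" for q
    using disjoint_if_sum_mset_eq_mset_set[of p "L + F" "{2..m}" q] assms that
    unfolding partial_system_def by auto
  then show ?thesis unfolding open_ends_def by (fastforce dest: hd_in_set last_in_set)
qed

lemma partial_system_set_subset: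
  assumes "partial_system A m L F" "p \<in># L + F"
  shows "p \<noteq> []" "set p \<subseteq> {2..m}"
proof -
  show "p \<noteq> []" using assms unfolding partial_system_def by auto
  have "mset p \<subseteq># (\<Sum>p\<in>#L + F. mset p)"
    using assms(2) by (metis image_mset_add_mset mset_subset_eq_add_left multi_member_split sum_mset.add_mset)
  then have "mset p \<subseteq># mset_set {2..m}" using assms(1) unfolding partial_system_def by simp
  then show "set p \<subseteq> {2..m}"
    by (metis finite_atLeastAtMost finite_set_mset_mset_set set_mset_mono set_mset_mset)
qed

lemma open_ends_subset:
  assumes "partial_system A m L F"
  shows "open_ends L F \<subseteq> {2..m}"
  using partial_system_set_subset[OF assms] hd_in_set last_in_set
  unfolding open_ends_def by (fastforce simp del: atLeastAtMost_iff)

section \<open>Reversal and extension of partial systems\<close>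

lemma open_ends_rev [simp]:
  "q \<noteq> [] \<Longrightarrow> open_ends L (add_mset (rev q) F) = open_ends L (add_mset q F)"
  by (auto simp: open_ends_def hd_rev last_rev)

lemma potential_rev [simp]:
  "potential L (add_mset (rev q) F) = potential L (add_mset q F)"
  by (auto simp: potential_def fun_eq_iff)

text \<open>Free paths carry no orientation, so a join may always be made at a prescribed side of
  the list.\<close>

lemma partial_system_rev:
  assumes "partial_system A m L (add_mset q F)" "symp A"
  shows "partial_system A m L (add_mset (rev q) F)"
proof -
  have "(\<lambda>x y. A y x) = A" using assms(2) by (auto simp: symp_def fun_eq_iff)
  then have "successively A (rev q) = successively A q" by (metis successively_rev)
  then show ?thesis using assms(1) unfolding partial_system_def by (simp del: successively_rev)
qed

lemma mset_set_atLeastAtMost_Suc: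
  "1 \<le> m \<Longrightarrow> mset_set {2..Suc m} = add_mset (Suc m) (mset_set {2..m})"
  by (simp add: atLeastAtMostSuc_conv)

lemma partial_system_new:
  assumes "partial_system A m L F" "1 \<le> m"
  shows "partial_system A (Suc m) L (add_mset [Suc m] F)"
  using assms by (auto simp: partial_system_def mset_set_atLeastAtMost_Suc)

lemma partial_system_join_leg:
  assumes "partial_system A m (add_mset p L) F" "1 \<le> m" "A (last p) (Suc m)"
  shows "partial_system A (Suc m) (add_mset (p @ [Suc m]) L) F"
  using assms by (auto simp: partial_system_def mset_set_atLeastAtMost_Suc successively_append_iff)

lemma partial_system_join_free:
  assumes "partial_system A m L (add_mset q F)" "1 \<le> m" "A (last q) (Suc m)"
  shows "partial_system A (Suc m) L (add_mset (q @ [Suc m]) F)"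
  using assms by (auto simp: partial_system_def mset_set_atLeastAtMost_Suc successively_append_iff)

lemma partial_system_join_leg_free:
  assumes "partial_system A m (add_mset p L) (add_mset q F)" "1 \<le> m"
    and "A (last p) (Suc m)" "A (Suc m) (hd q)"
  shows "partial_system A (Suc m) (add_mset (p @ Suc m # q) L) F"
  using assms
  by (auto simp: partial_system_def mset_set_atLeastAtMost_Suc successively_append_iff
      successively_Cons ac_simps)

lemma partial_system_join_free_free:
  assumes "partial_system A m L (add_mset p (add_mset q F))" "1 \<le> m"
    and "A (last p) (Suc m)" "A (Suc m) (hd q)"
  shows "partial_system A (Suc m) L (add_mset (p @ Suc m # q) F)"
  using assms
  by (auto simp: partial_system_def mset_set_atLeastAtMost_Suc successively_append_iff
      successively_Cons ac_simps)

text \<open>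
  If \<open>x\<close> stays open, each of its neighbours that is processed decreases the potential of \<open>x\<close>,
  whether it is joined to \<open>x\<close> or passes over \<open>x\<close>.
\<close>

definition step_ok ::
    "(nat \<Rightarrow> nat \<Rightarrow> bool) \<Rightarrow> nat \<Rightarrow> nat list multiset \<Rightarrow> nat list multiset \<Rightarrow>
     nat list multiset \<Rightarrow> nat list multiset \<Rightarrow> bool" where
  "step_ok A m L F L' F' \<longleftrightarrow>
     partial_system A (Suc m) L' F' \<and> size L' = size L \<and>
     (\<forall>x\<in>open_ends L' F'. x \<le> m \<longrightarrow> x \<in> open_ends L F \<and>
        of_bool (A x (Suc m)) + potential L' F' x \<le> potential L F x)"

section \<open>The five ways to process a vertex, and the greedy step\<close>

text \<open>All ends lie in \<open>C\<close>, so \<open>size F + size L \<le> card C\<close>. The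
  new singleton weighs 2 and the legs \<open>size L - 1\<close>, which exceeds this count by one;
  \<open>size L \<ge> 1\<close> absorbs it.\<close>

lemma step_new:
  assumes sys: "partial_system A m L F" "1 \<le> m" "L \<noteq> {#}"
    and none: "\<forall>x\<in>open_ends L F. \<not> A x (Suc m)"
    and C: "finite C" "\<forall>x\<in>open_ends L F. \<not> A x (Suc m) \<longrightarrow> x \<in> C"
  shows "step_ok A m L F L (add_mset [Suc m] F) \<and>
    potential L (add_mset [Suc m] F) (Suc m) \<le> card C + size L"
proof
  have ends: "open_ends L (add_mset [Suc m] F) = insert (Suc m) (open_ends L F)"
    by (auto simp: open_ends_def)
  have pot: "potential L (add_mset [Suc m] F) x = potential L F x" if "x \<le> m" for x
    using that by (simp add: potential_def free_weight_def)
  show "step_ok A m L F L (add_mset [Suc m] F)"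
    unfolding step_ok_def ends using partial_system_new[OF sys(1,2)] none by (auto simp: pot)
  have less: "\<forall>x\<in>open_ends L F. x < Suc m" using open_ends_subset[OF sys(1)] by auto
  then have "potential L (add_mset [Suc m] F) (Suc m) = size F + 2 + (size L - 1)"
    unfolding potential_def
    by (subst image_mset_add_mset, subst sum_mset.add_mset, subst sum_free_weight_if_less)
      (auto simp: free_weight_def leg_weight_def open_ends_def)
  moreover have "size (image_mset hd F + image_mset last L) \<le> card C"
    by (rule size_le_card_if_subseteq_mset_set[OF partial_system_ends_subseteq[OF sys(1)] _ C(1)])
      (use none C(2) in \<open>auto simp: open_ends_def\<close>)
  moreover have "size L \<ge> 1" using sys(3) by (simp add: Suc_le_eq nonempty_has_size)
  ultimately show "potential L (add_mset [Suc m] F) (Suc m) \<le> card C + size L" by simp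
qed

text \<open>Other leg ends may be adjacent to the new vertex, so only the free paths are counted
  inside \<open>C\<close>; the legs contribute at most their number.\<close>

lemma step_join_leg:
  assumes sys: "partial_system A m (add_mset p L) F" "1 \<le> m" "A (last p) (Suc m)"
    and none: "\<forall>q\<in>#F. \<not> A (hd q) (Suc m) \<and> \<not> A (last q) (Suc m)"
    and least: "\<forall>x\<in>open_ends (add_mset p L) F. A x (Suc m) \<longrightarrow> last p \<le> x"
    and C: "finite C" "\<forall>x\<in>open_ends (add_mset p L) F. \<not> A x (Suc m) \<longrightarrow> x \<in> C"
  shows "step_ok A m (add_mset p L) F (add_mset (p @ [Suc m]) L) F \<and>
    potential (add_mset (p @ [Suc m]) L) F (Suc m) \<le> card C + size (add_mset p L)"
proof
  have p: "last p \<in> set p" using partial_system_set_subset(1)[OF sys(1)] by simp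
  have ends: "open_ends (add_mset (p @ [Suc m]) L) F = insert (Suc m) (open_ends L F)"
    "open_ends (add_mset p L) F = insert (last p) (open_ends L F)"
    by (auto simp: open_ends_def)
  have disj: "last p \<notin> open_ends L F" using partial_system_leg_disjoint[OF sys(1)] p by auto
  have "of_bool (A x (Suc m)) + potential (add_mset (p @ [Suc m]) L) F x
      \<le> potential (add_mset p L) F x"
    if "x \<le> m" "x \<in> open_ends L F" for x
    by (rule potential_join_leg) (use that disj none least in \<open>auto simp: open_ends_def\<close>)
  then show "step_ok A m (add_mset p L) F (add_mset (p @ [Suc m]) L) F"
    unfolding step_ok_def ends using partial_system_join_leg[OF sys] by auto
  have less: "\<forall>x\<in>open_ends (add_mset p L) F. x < Suc m" using open_ends_subset[OF sys(1)] by auto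
  have "(\<Sum>q\<in>#F. free_weight (Suc m) q) = size F"
    by (rule sum_free_weight_if_less) (use less in \<open>auto simp: open_ends_def\<close>)
  moreover have "leg_weight (add_mset (p @ [Suc m]) L) (Suc m) \<le> size (add_mset p L)"
    by (auto simp: leg_weight_def size_filter_mset_lesseq)
  moreover have "size (image_mset hd F) \<le> card C"
    by (rule size_le_card_if_subseteq_mset_set[OF
          subset_mset.order_trans[OF _ partial_system_ends_subseteq[OF sys(1)]] _ C(1)])
      (use none C(2) in \<open>auto simp: open_ends_def\<close>)
  ultimately show "potential (add_mset (p @ [Suc m]) L) F (Suc m) \<le> card C + size (add_mset p L)"
    unfolding potential_def by simp
qed

text \<open>Besides \<open>last q\<close>, only \<open>hd q\<close> can be adjacent, and joining it
  would close a cycle. Hence \<open>q\<close> is left out of the count, and the ends of all other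
  paths lie in \<open>C\<close>.\<close>

lemma step_join_free:
  assumes sys: "partial_system A m L (add_mset q F)" "1 \<le> m" "A (last q) (Suc m)" "L \<noteq> {#}"
    and none: "\<forall>x\<in>open_ends L F. \<not> A x (Suc m)"
    and least: "A (hd q) (Suc m) \<longrightarrow> last q \<le> hd q"
    and C: "finite C" "\<forall>x\<in>open_ends L (add_mset q F). \<not> A x (Suc m) \<longrightarrow> x \<in> C"
  shows "step_ok A m L (add_mset q F) L (add_mset (q @ [Suc m]) F) \<and>
    potential L (add_mset (q @ [Suc m]) F) (Suc m) \<le> card C + size L"
proof
  have q: "q \<noteq> []" using partial_system_set_subset(1)[OF sys(1)] by simp
  have ends: "open_ends L (add_mset (q @ [Suc m]) F) = {hd q, Suc m} \<union> open_ends L F"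
    "open_ends L (add_mset q F) = {hd q, last q} \<union> open_ends L F"
    using q by (auto simp: open_ends_def)
  have "of_bool (A x (Suc m)) + potential L (add_mset (q @ [Suc m]) F) x
      \<le> potential L (add_mset q F) x"
    if "x \<le> m" "x = hd q \<or> x \<in> open_ends L F" for x
    by (rule potential_join_free) (use that q none least in auto)
  then show "step_ok A m L (add_mset q F) L (add_mset (q @ [Suc m]) F)"
    unfolding step_ok_def ends using partial_system_join_free[OF sys(1-3)] by auto
  have less: "\<forall>x\<in>open_ends L (add_mset q F). x < Suc m" using open_ends_subset[OF sys(1)] by auto
  have "(\<Sum>q\<in>#F. free_weight (Suc m) q) = size F"
    by (rule sum_free_weight_if_less) (use less in \<open>auto simp: open_ends_def\<close>)
  moreover have "free_weight (Suc m) (q @ [Suc m]) = 2" "leg_weight L (Suc m) = size L - 1"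
    using less q by (auto simp: free_weight_def leg_weight_def open_ends_def)
  moreover have "image_mset hd F + image_mset last L
      \<subseteq># image_mset hd (add_mset q F) + image_mset last L" by simp
  then have "size (image_mset hd F + image_mset last L) \<le> card C"
    by (intro size_le_card_if_subseteq_mset_set[OF
          subset_mset.order_trans[OF _ partial_system_ends_subseteq[OF sys(1)]] _ C(1)])
      (use none C(2) in \<open>auto simp: open_ends_def\<close>)
  moreover have "size L \<ge> 1" using sys(4) by (simp add: Suc_le_eq nonempty_has_size)
  ultimately show "potential L (add_mset (q @ [Suc m]) F) (Suc m) \<le> card C + size L"
    unfolding potential_def by simp
qed

text \<open>Minimality is stated separately for leg ends and free ends, so that the lemma serves
  whichever of the two was chosen first. The new vertex becomes an inner vertex, so its potential
  requires no bound.\<close>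

lemma step_join_leg_free:
  assumes sys: "partial_system A m (add_mset p L) (add_mset q F)" "1 \<le> m"
    "A (last p) (Suc m)" "A (Suc m) (hd q)"
    and leg: "\<forall>x\<in>last ` set_mset L. A x (Suc m) \<longrightarrow> last p \<le> x"
    and free: "\<forall>x\<in>open_ends {#} (add_mset q F). A x (Suc m) \<longrightarrow> hd q \<le> x"
  shows "step_ok A m (add_mset p L) (add_mset q F) (add_mset (p @ Suc m # q) L) F \<and>
    Suc m \<notin> open_ends (add_mset (p @ Suc m # q) L) F"
proof
  have pq: "p \<noteq> []" "q \<noteq> []" using partial_system_set_subset(1)[OF sys(1)] by simp_all
  have ends: "open_ends (add_mset (p @ Suc m # q) L) F = insert (last q) (open_ends L F)"
    "open_ends (add_mset p L) (add_mset q F) = {last p, hd q, last q} \<union> open_ends L F"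
    using pq by (auto simp: open_ends_def)
  have disj: "last p \<notin> open_ends L (add_mset q F)"
    using partial_system_leg_disjoint[OF sys(1)] last_in_set[OF pq(1)] by auto
  have "of_bool (A x (Suc m)) + potential (add_mset (p @ Suc m # q) L) F x
      \<le> potential (add_mset p L) (add_mset q F) x"
    if "x = last q \<or> x \<in> open_ends L F" for x
    by (rule potential_join_leg_free) (use that pq disj leg free in \<open>auto simp: open_ends_def\<close>)
  then show "step_ok A m (add_mset p L) (add_mset q F) (add_mset (p @ Suc m # q) L) F"
    unfolding step_ok_def ends using partial_system_join_leg_free[OF sys] by auto
  show "Suc m \<notin> open_ends (add_mset (p @ Suc m # q) L) F"
    using open_ends_subset[OF sys(1)] ends by auto
qed

text \<open>The second choice is least only among the ends outside \<open>p\<close>, since joining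
  both ends of \<open>p\<close> would close a cycle.\<close>

lemma step_join_free_free:
  assumes sys: "partial_system A m L (add_mset p (add_mset q F))" "1 \<le> m"
    "A (last p) (Suc m)" "A (Suc m) (hd q)"
    and least: "\<forall>x\<in>open_ends L (add_mset p (add_mset q F)). A x (Suc m) \<longrightarrow> last p \<le> x"
    and least': "\<forall>x\<in>open_ends L (add_mset q F). A x (Suc m) \<longrightarrow> hd q \<le> x"
  shows "step_ok A m L (add_mset p (add_mset q F)) L (add_mset (p @ Suc m # q) F) \<and>
    Suc m \<notin> open_ends L (add_mset (p @ Suc m # q) F)"
proof
  have pq: "p \<noteq> []" "q \<noteq> []" using partial_system_set_subset(1)[OF sys(1)] by simp_all
  have ends: "open_ends L (add_mset (p @ Suc m # q) F) = {hd p, last q} \<union> open_ends L F"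
    "open_ends L (add_mset p (add_mset q F)) = {hd p, last p, hd q, last q} \<union> open_ends L F"
    "open_ends L (add_mset q F) = {hd q, last q} \<union> open_ends L F"
    using pq by (auto simp: open_ends_def)
  have "of_bool (A x (Suc m)) + potential L (add_mset (p @ Suc m # q) F) x
      \<le> potential L (add_mset p (add_mset q F)) x"
    if "x = hd p \<or> x = last q \<or> x \<in> open_ends L F" for x
    by (rule potential_join_free_free) (use that pq least least' ends in auto)
  then show "step_ok A m L (add_mset p (add_mset q F)) L (add_mset (p @ Suc m # q) F)"
    unfolding step_ok_def ends using partial_system_join_free_free[OF sys] by auto
  show "Suc m \<notin> open_ends L (add_mset (p @ Suc m # q) F)"
    using open_ends_subset[OF sys(1)] ends by auto
qed

lemma step_ok_rev:
  assumes "q \<noteq> []"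
  shows "step_ok A m L (add_mset (rev q) F) L' F' = step_ok A m L (add_mset q F) L' F'"
  using assms by (simp add: step_ok_def)

lemma free_end_cases:
  assumes "z \<in> hd ` set_mset F \<union> last ` set_mset F" "\<forall>q\<in>#F. q \<noteq> []"
  obtains q q' F' where "F = add_mset q F'" "q' = q \<or> q' = rev q" "q' \<noteq> []" "last q' = z"
proof -
  obtain q where q: "q \<in># F" "z = hd q \<or> z = last q" using assms(1) by auto
  then obtain F' where F': "F = add_mset q F'" by (metis multi_member_split)
  have "q \<noteq> []" using q assms(2) by auto
  then show ?thesis using that[OF F', of q] that[OF F', of "rev q"] q(2) by (auto simp: last_rev)
qed

text \<open>The greedy rule picks the least adjacent end and then the least admissible second one.
  \<open>C\<close> stands for the non-neighbours of the new vertex before it.\<close>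

lemma partial_system_step:
  assumes sys: "partial_system A m L F" "symp A" "1 \<le> m" "L \<noteq> {#}"
    and C: "finite C" "\<forall>x\<in>open_ends L F. \<not> A x (Suc m) \<longrightarrow> x \<in> C"
  shows "\<exists>L' F'. step_ok A m L F L' F' \<and>
    (Suc m \<in> open_ends L' F' \<longrightarrow> potential L' F' (Suc m) \<le> card C + size L)"
proof -
  have fin: "finite (open_ends L F)" for L F :: "nat list multiset" by (simp add: open_ends_def)
  have ne: "\<forall>q\<in>#F. q \<noteq> []" using sys(1) by (auto simp: partial_system_def)
  define S where "S L F = {x \<in> open_ends L F. A x (Suc m)}" for L F
  have finS: "finite (S L F)" for L F by (simp add: S_def fin)
  consider (none) "S L F = {}" | (leg) "S L F \<noteq> {}" "Min (S L F) \<in> last ` set_mset L"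
    | (free) "S L F \<noteq> {}" "Min (S L F) \<in> hd ` set_mset F \<union> last ` set_mset F"
    using Min_in[OF finS, of L F] unfolding S_def open_ends_def by blast
  then show ?thesis
  proof cases
    case none
    then have "\<forall>x\<in>open_ends L F. \<not> A x (Suc m)" unfolding S_def by auto
    then show ?thesis using step_new[OF sys(1,3,4) _ C] by blast
  next
    case leg
    then obtain p L0 where L: "L = add_mset p L0" and p: "last p = Min (S L F)"
      by (metis (no_types, lifting) imageE multi_member_split)
    have Ap: "A (last p) (Suc m)" using Min_in[OF finS leg(1)] p by (simp add: S_def)
    have least: "last p \<le> x" if "x \<in> open_ends L F" "A x (Suc m)" for x
      using that p Min_le[OF finS] by (simp add: S_def)
    \<comment> \<open>A second leg end is forbidden, so the second choice is made among free ends
      only, which \<open>S {#} F\<close> expresses.\<close>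
    show ?thesis
    proof (cases "S {#} F = {}")
      case True
      then have "\<forall>q\<in>#F. \<not> A (hd q) (Suc m) \<and> \<not> A (last q) (Suc m)"
        unfolding S_def open_ends_def by auto
      then show ?thesis using step_join_leg[of A m p L0 F C] sys(1,3) Ap least C unfolding L by blast
    next
      case False
      have in_F: "Min (S {#} F) \<in> hd ` set_mset F \<union> last ` set_mset F"
        using Min_in[OF finS False] by (auto simp: S_def open_ends_def)
      obtain q q' F0 where F: "F = add_mset q F0" "q' = q \<or> q' = rev q" "q' \<noteq> []"
        and q': "last q' = Min (S {#} F)"
        by (rule free_end_cases[OF in_F ne])
      have "q \<noteq> []" "hd (rev q') = Min (S {#} F)" using F q' by (auto simp: hd_rev)
      have sys': "partial_system A m (add_mset p L0) (add_mset (rev q') F0)"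
        using sys(1) partial_system_rev[OF sys(1)[unfolded F] sys(2)] F(2) unfolding L F by auto
      have eq: "open_ends {#} (add_mset (rev q') F0) = open_ends {#} F"
        using F \<open>q \<noteq> []\<close> by auto
      have "step_ok A m (add_mset p L0) (add_mset (rev q') F0) (add_mset (p @ Suc m # rev q') L0) F0 \<and>
        Suc m \<notin> open_ends (add_mset (p @ Suc m # rev q') L0) F0"
      proof (rule step_join_leg_free[OF sys' sys(3) Ap])
        show "A (Suc m) (hd (rev q'))"
          using Min_in[OF finS False] \<open>hd (rev q') = _\<close> sympD[OF sys(2)] by (simp add: S_def)
        show "\<forall>x\<in>last ` set_mset L0. A x (Suc m) \<longrightarrow> last p \<le> x"
          using least by (auto simp: L open_ends_def)
        show "\<forall>x\<in>open_ends {#} (add_mset (rev q') F0). A x (Suc m) \<longrightarrow> hd (rev q') \<le> x"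
          unfolding eq \<open>hd (rev q') = _\<close> using Min_le[OF finS] by (simp add: S_def)
      qed
      then show ?thesis using F(2) \<open>q \<noteq> []\<close> unfolding L F(1) by (metis rev_rev_ident step_ok_rev)
    qed
  next
    case free
    obtain q q' F0 where F: "F = add_mset q F0" "q' = q \<or> q' = rev q" "q' \<noteq> []"
      and q': "last q' = Min (S L F)"
      by (rule free_end_cases[OF free(2) ne])
    have "q \<noteq> []" using F by auto
    have sys': "partial_system A m L (add_mset q' F0)"
      using sys(1) partial_system_rev[OF sys(1)[unfolded F] sys(2)] F(2) unfolding F by auto
    have ends: "open_ends L (add_mset q' F0) = open_ends L F" using F \<open>q \<noteq> []\<close> by auto
    have step: "step_ok A m L (add_mset q' F0) L' F' = step_ok A m L F L' F'" for L' F'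
      using F \<open>q \<noteq> []\<close> step_ok_rev by auto
    have Aq: "A (last q') (Suc m)" using Min_in[OF finS free(1)] q' by (simp add: S_def)
    have least: "last q' \<le> x" if "x \<in> open_ends L F" "A x (Suc m)" for x
      using that q' Min_le[OF finS] by (simp add: S_def)
    have "hd q' \<in> open_ends L (add_mset q' F0)" by (simp add: open_ends_def)
    then have hd_q': "hd q' \<in> open_ends L F" by (simp only: ends)
    \<comment> \<open>Removing \<open>q'\<close> from the free paths rules out a cycle; leg ends
      remain admissible.\<close>
    show ?thesis
    proof (cases "S L F0 = {}")
      case True
      then have "\<forall>x\<in>open_ends L F0. \<not> A x (Suc m)" unfolding S_def by auto
      from step_join_free[OF sys' sys(3) Aq sys(4) this _ C(1)] show ?thesis
        using least hd_q' C(2) unfolding ends step by blast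
    next
      case False
      have A0: "A (Min (S L F0)) (Suc m)" using Min_in[OF finS False] by (simp add: S_def)
      have least': "Min (S L F0) \<le> x" if "x \<in> open_ends L F0" "A x (Suc m)" for x
        using that Min_le[OF finS] by (simp add: S_def)
      consider (leg) "Min (S L F0) \<in> last ` set_mset L"
        | (free) "Min (S L F0) \<in> hd ` set_mset F0 \<union> last ` set_mset F0"
        using Min_in[OF finS False] unfolding S_def open_ends_def by blast
      then show ?thesis
      proof cases
        case leg
        then obtain p L0 where L: "L = add_mset p L0" and p: "last p = Min (S L F0)"
          by (metis (no_types, lifting) imageE multi_member_split)
        have hd: "hd (rev q') = last q'" using F(3) by (simp add: hd_rev)
        have sys'': "partial_system A m (add_mset p L0) (add_mset (rev q') F0)"
          using partial_system_rev[OF sys' sys(2)] unfolding L .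
        have "step_ok A m (add_mset p L0) (add_mset (rev q') F0) (add_mset (p @ Suc m # rev q') L0) F0 \<and>
          Suc m \<notin> open_ends (add_mset (p @ Suc m # rev q') L0) F0"
        proof (rule step_join_leg_free[OF sys'' sys(3)])
          show "A (last p) (Suc m)" using A0 p by simp
          show "A (Suc m) (hd (rev q'))" using Aq hd sympD[OF sys(2)] by simp
          show "\<forall>x\<in>last ` set_mset L0. A x (Suc m) \<longrightarrow> last p \<le> x"
            unfolding p using least' by (auto simp: L open_ends_def)
          have "open_ends {#} (add_mset q' F0) \<subseteq> open_ends L F"
            unfolding ends[symmetric] by (auto simp: open_ends_def)
          then show "\<forall>x\<in>open_ends {#} (add_mset (rev q') F0). A x (Suc m) \<longrightarrow> hd (rev q') \<le> x"
            unfolding hd open_ends_rev[OF F(3)] using least by blast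
        qed
        then show ?thesis using F(3) step unfolding L by (metis step_ok_rev)
      next
        case free
        have "\<forall>q\<in>#F0. q \<noteq> []" using ne F by simp
        then obtain r r' F1 where r: "F0 = add_mset r F1" "r' = r \<or> r' = rev r" "r' \<noteq> []"
          and r': "last r' = Min (S L F0)"
          using free_end_cases[OF free] by metis
        have "r \<noteq> []" using r by auto
        have hd: "hd (rev r') = Min (S L F0)" using r r' by (simp add: hd_rev)
        have sys'': "partial_system A m L (add_mset q' (add_mset (rev r') F1))"
          using sys' partial_system_rev[of A m L r "add_mset q' F1"] sys(2) r(2)
          unfolding r(1) by (auto simp: add_mset_commute)
        have ends': "open_ends L (add_mset (rev r') F1) = open_ends L F0"
          "open_ends L (add_mset q' (add_mset (rev r') F1)) = open_ends L F"
          using r \<open>r \<noteq> []\<close> unfolding ends[symmetric] by (auto simp: open_ends_def hd_rev last_rev)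
        have "step_ok A m L (add_mset q' (add_mset (rev r') F1)) L (add_mset (q' @ Suc m # rev r') F1) \<and>
          Suc m \<notin> open_ends L (add_mset (q' @ Suc m # rev r') F1)"
        proof (rule step_join_free_free[OF sys'' sys(3) Aq])
          show "A (Suc m) (hd (rev r'))" unfolding hd using A0 sympD[OF sys(2)] by simp
          show "\<forall>x\<in>open_ends L (add_mset q' (add_mset (rev r') F1)). A x (Suc m) \<longrightarrow> last q' \<le> x"
            unfolding ends' using least by simp
          show "\<forall>x\<in>open_ends L (add_mset (rev r') F1). A x (Suc m) \<longrightarrow> hd (rev r') \<le> x"
            unfolding ends' hd using least' by simp
        qed
        moreover have "step_ok A m L (add_mset q' (add_mset (rev r') F1)) L' F' =
            step_ok A m L (add_mset q' F0) L' F'" for L' F'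
          using r \<open>r \<noteq> []\<close> step_ok_rev[of _ A m L "add_mset q' F1" L' F']
          by (auto simp: add_mset_commute)
        ultimately show ?thesis using step by blast
      qed
    qed
  qed
qed

section \<open>Consequences of the bandwidth and degree conditions\<close>

locale bandwidth_graph =
  fixes A :: "nat \<Rightarrow> nat \<Rightarrow> bool" and n k l :: nat
  assumes sym: "symp A" and irrefl: "\<And>i. \<not> A i i"
    and l_pos: "1 \<le> l" and l_le: "l \<le> k" and n_ge: "l + 2 \<le> n"
    and bandwidth: "\<And>i j. i \<in> {1..n} \<Longrightarrow> j \<in> {1..n} \<Longrightarrow> A i j \<Longrightarrow> i \<le> j + k"
    and degree: "\<And>i. i \<in> {1..n} \<Longrightarrow>
      min (k + l) (min (i - 1) k + min (n - i) k) \<le> card {j \<in> {1..n}. A i j}"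
begin

definition missing :: "nat \<Rightarrow> nat set" where
  "missing x = {z \<in> {1..<x}. x \<le> z + k \<and> \<not> A z x}"

definition right_nbs :: "nat \<Rightarrow> nat \<Rightarrow> nat set" where
  "right_nbs t x = {j \<in> {x<..t}. A x j}"

lemma A_sym: "A i j \<longleftrightarrow> A j i"
  using sym by (auto dest: sympD)

lemma finite_missing [simp]: "finite (missing x)" and finite_right_nbs [simp]: "finite (right_nbs t x)"
  by (simp_all add: missing_def right_nbs_def)

text \<open>Left neighbours and \<open>missing x\<close> partition the at most \<open>k\<close>
  vertices before \<open>x\<close>, and every other neighbour lies to the right. The additive form
  avoids truncated subtraction.\<close>

lemma degree_le_right_nbs:
  assumes "x \<in> {1..n}"
  shows "min (k + l) (min (x - 1) k + min (n - x) k) + card (missing x)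
    \<le> min (x - 1) k + card (right_nbs n x)"
proof -
  let ?left = "{z \<in> {1..<x}. x \<le> z + k \<and> A z x}"
  have fin: "finite ?left" by simp
  have "{j \<in> {1..n}. A x j} \<subseteq> ?left \<union> right_nbs n x"
  proof
    fix j assume j: "j \<in> {j \<in> {1..n}. A x j}"
    then have "x \<noteq> j" "A j x" "x \<le> j + k"
      using bandwidth[OF assms, of j] irrefl A_sym[of x j] by auto
    then show "j \<in> ?left \<union> right_nbs n x" using j by (auto simp: right_nbs_def)
  qed
  then have "card {j \<in> {1..n}. A x j} \<le> card (?left \<union> right_nbs n x)"
    by (rule card_mono[rotated]) simp
  also have "\<dots> \<le> card ?left + card (right_nbs n x)" by (rule card_Un_le)
  finally have deg: "min (k + l) (min (x - 1) k + min (n - x) k) \<le> card ?left + card (right_nbs n x)"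
    using degree[OF assms] by (rule order_trans[rotated])
  have "card ?left + card (missing x) = card (?left \<union> missing x)"
    by (rule card_Un_disjoint[symmetric]) (auto simp: missing_def)
  moreover have "?left \<union> missing x = {max 1 (x - k)..<x}"
    using assms by (auto simp: missing_def)
  moreover have "card {max 1 (x - k)..<x} = min (x - 1) k" using assms by auto
  ultimately have split: "card ?left + card (missing x) = min (x - 1) k" by simp
  have "d + b \<le> c + r" if "d \<le> a + r" "a + b = c" for a b c d r :: nat using that by simp
  from this[OF deg split] show ?thesis .
qed

text \<open>Since \<open>min (x - 1) k \<le> k\<close>, this term can be split off the degree bound
  and cancelled.\<close>

lemma missing_le_card_right_nbs:
  assumes "x \<in> {1..n}"
  shows "min l (min (n - x) k) + card (missing x) \<le> card (right_nbs n x)"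
proof -
  have "min (x - 1) k + min l (min (n - x) k) \<le> min (k + l) (min (x - 1) k + min (n - x) k)"
    by (intro min.boundedI add_mono) auto
  then have "min (x - 1) k + min l (min (n - x) k) + card (missing x)
      \<le> min (x - 1) k + card (right_nbs n x)"
    using degree_le_right_nbs[OF assms] by (meson add_le_mono1 order_trans)
  then show ?thesis by (metis add.assoc nat_add_left_cancel_le)
qed

lemma right_nbs_subset:
  assumes "x \<in> {1..n}"
  shows "right_nbs n x \<subseteq> right_nbs (x + k) x"
proof
  fix j assume "j \<in> right_nbs n x"
  then show "j \<in> right_nbs (x + k) x"
    using assms bandwidth[of j x] A_sym[of x j] by (auto simp: right_nbs_def)
qed

text \<open>Here the degree condition demands the full degree of \<open>x\<close> in the
  \<open>k\<close>-th power of the path, and the right side supplies at most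
  \<open>min (n - x) k\<close> of it.\<close>

lemma missing_empty:
  assumes "x \<in> {1..n}" "min (x - 1) k + min (n - x) k \<le> k + l"
  shows "missing x = {}"
proof -
  have "right_nbs n x \<subseteq> {x<..min n (x + k)}"
    using right_nbs_subset[OF assms(1)] by (auto simp: right_nbs_def)
  then have "card (right_nbs n x) \<le> card {x<..min n (x + k)}" by (intro card_mono) simp_all
  also have "\<dots> = min (n - x) k" using assms(1) by auto
  finally have "card (right_nbs n x) \<le> min (n - x) k" .
  moreover have "min (x - 1) k + min (n - x) k + card (missing x)
      \<le> min (x - 1) k + card (right_nbs n x)"
    using degree_le_right_nbs[OF assms(1)] unfolding min_absorb2[OF assms(2)] .
  ultimately have "card (missing x) = 0" by linarith
  then show ?thesis by simp
qed

lemma missing_le_right_nbs: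
  assumes "x \<in> {1..n}" "x + k \<le> n - 1"
  shows "l + card (missing x) \<le> card (right_nbs (x + k) x)"
proof -
  have "min l (min (n - x) k) = l" using assms(2) l_le by auto
  then have "l + card (missing x) \<le> card (right_nbs n x)"
    using missing_le_card_right_nbs[OF assms(1)] by simp
  also have "\<dots> \<le> card (right_nbs (x + k) x)"
    using right_nbs_subset[OF assms(1)] by (simp add: card_mono)
  finally show ?thesis .
qed

text \<open>Discarding the neighbour \<open>n\<close> costs at most one, which is covered by
  \<open>min l (min (n - x) k) \<ge> 1\<close>.\<close>

lemma missing_le_right_nbs_end:
  assumes "x \<in> {1..n - 1}"
  shows "card (missing x) \<le> card (right_nbs (n - 1) x)"
proof -
  have "right_nbs n x \<subseteq> insert n (right_nbs (n - 1) x)"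
    by (auto simp: right_nbs_def)
  then have "card (right_nbs n x) \<le> card (insert n (right_nbs (n - 1) x))"
    by (intro card_mono) simp_all
  also have "\<dots> \<le> Suc (card (right_nbs (n - 1) x))" by (simp add: card_insert_if)
  finally have "card (right_nbs n x) \<le> Suc (card (right_nbs (n - 1) x))" .
  moreover have "x \<in> {1..n}" "1 \<le> min l (min (n - x) k)" using assms l_pos l_le by auto
  then have "1 + card (missing x) \<le> card (right_nbs n x)"
    using missing_le_card_right_nbs[of x] by (meson add_le_mono1 order_trans)
  ultimately show ?thesis by simp
qed

text \<open>These vertices have so few predecessors that nothing is missing, and \<open>1\<close> is
  within distance \<open>k\<close> because \<open>x \<le> k + 1\<close>. This provides the initial
  legs.\<close>

lemma first_adjacent:
  assumes "x \<in> {2..l + 1}"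
  shows "A 1 x"
proof -
  have "min (x - 1) k + min (n - x) k \<le> l + k"
    using assms by (intro add_mono) auto
  then have "missing x = {}" using assms n_ge by (intro missing_empty) auto
  then have "1 \<notin> missing x" by simp
  then show ?thesis using assms l_le by (auto simp: missing_def)
qed

lemma last_adjacent:
  assumes "x \<in> {1..n - 1}" "n \<le> x + k"
  shows "A x n"
proof -
  have "missing n = {}" using n_ge by (intro missing_empty) auto
  then have "x \<notin> missing n" by simp
  then show ?thesis using assms by (auto simp: missing_def)
qed

section \<open>The invariant and its consequences at the last vertex\<close>

text \<open>The bound \<open>card (missing x) + l\<close> is the budget of \<open>x\<close> when it
  is processed; each later neighbour spends one unit while \<open>x\<close> stays an end.\<close>

definition good_state :: "nat \<Rightarrow> nat list multiset \<Rightarrow> nat list multiset \<Rightarrow> bool" where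
  "good_state t L F \<longleftrightarrow> partial_system A t L F \<and> size L = l \<and>
     (\<forall>x\<in>open_ends L F. card (right_nbs t x) + potential L F x \<le> card (missing x) + l)"

text \<open>After \<open>k\<close> steps all right neighbours of \<open>x\<close> have been
  processed; there are enough of them to exhaust the budget, whereas an end has positive
  potential.\<close>

lemma good_state_recent:
  assumes "good_state t L F" "x \<in> open_ends L F" "t \<le> n - 1"
  shows "t < x + k"
proof (rule ccontr)
  assume "\<not> t < x + k"
  moreover have "x \<in> {2..t}" using assms open_ends_subset unfolding good_state_def by blast
  ultimately have "l + card (missing x) \<le> card (right_nbs (x + k) x)"
    using assms(3) by (intro missing_le_right_nbs) auto
  also have "\<dots> \<le> card (right_nbs t x)"
    using \<open>\<not> t < x + k\<close> by (intro card_mono) (auto simp: right_nbs_def)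
  finally have "l + card (missing x) \<le> card (right_nbs t x)" .
  moreover have "card (right_nbs t x) + potential L F x \<le> card (missing x) + l"
    using assms(1,2) unfolding good_state_def by blast
  ultimately show False using potential_pos[OF assms(2)] by linarith
qed

lemma good_state_init:
  "good_state (l + 1) (image_mset (\<lambda>j. [j]) (mset_set {2..l + 1})) {#}"
proof -
  let ?L = "image_mset (\<lambda>j. [j]) (mset_set {2..l + 1})"
  have "(\<Sum>p\<in>#?L. mset p) = mset_set {2..l + 1}"
    by (simp add: image_mset.compositionality comp_def del: atLeastAtMostSuc_conv)
  moreover have "A 1 j" if "j \<in> {2..l + 1}" for j
    using that by (rule first_adjacent)
  ultimately have "partial_system A (l + 1) ?L {#}"
    unfolding partial_system_def by auto
  moreover have "card (right_nbs (l + 1) x) + potential ?L {#} x \<le> card (missing x) + l"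
    if "x \<in> open_ends ?L {#}" for x
  proof -
    have x: "x \<in> {2..l + 1}" using that by (auto simp: open_ends_def)
    have "filter_mset (\<lambda>p. last p \<le> x) ?L = image_mset (\<lambda>j. [j]) (mset_set {j \<in> {2..l + 1}. j \<le> x})"
      by (simp add: filter_mset_image_mset)
    moreover have "{j \<in> {2..l + 1}. j \<le> x} = {2..x}" using x by auto
    moreover have "x \<in> last ` set_mset ?L" using that by (simp add: open_ends_def)
    \<comment> \<open>The legs ending in \<open>2, ..., x\<close> are counted. At most
      \<open>l + 1 - x\<close> right neighbours are processed, so the sum is at most
      \<open>l\<close>.\<close>
    ultimately have "potential ?L {#} x = x - 1"
      by (simp add: potential_def leg_weight_def)
    moreover have "card (right_nbs (l + 1) x) \<le> card {x<..l + 1}"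
      by (intro card_mono) (auto simp: right_nbs_def)
    ultimately have "card (right_nbs (l + 1) x) + potential ?L {#} x \<le> (l + 1 - x) + (x - 1)"
      by simp
    then show ?thesis using x by auto
  qed
  ultimately show ?thesis by (simp add: good_state_def)
qed

lemma good_state_step:
  assumes "good_state t L F" "1 \<le> t" "t < n - 1"
  shows "\<exists>L' F'. good_state (Suc t) L' F'"
proof -
  have sys: "partial_system A t L F" and L: "size L = l"
    and inv: "\<And>x. x \<in> open_ends L F \<Longrightarrow>
      card (right_nbs t x) + potential L F x \<le> card (missing x) + l"
    using assms(1) unfolding good_state_def by blast+
  \<comment> \<open>The strict bound \<open>t < x + k\<close> puts every end within distance
    \<open>k\<close> of \<open>Suc t\<close>, the range covered by
    \<open>missing (Suc t)\<close>.\<close>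
  have "\<forall>x\<in>open_ends L F. \<not> A x (Suc t) \<longrightarrow> x \<in> missing (Suc t)"
    using open_ends_subset[OF sys] good_state_recent[OF assms(1)] assms(3)
    by (fastforce simp: missing_def)
  moreover have "L \<noteq> {#}" using L l_pos by auto
  ultimately obtain L' F' where step: "step_ok A t L F L' F'"
    and new: "Suc t \<in> open_ends L' F' \<Longrightarrow> potential L' F' (Suc t) \<le> card (missing (Suc t)) + l"
    using partial_system_step[OF sys sym assms(2) _ finite_missing] L by metis
  have "good_state (Suc t) L' F'"
    unfolding good_state_def
  proof (intro conjI ballI)
    show sys': "partial_system A (Suc t) L' F'" "size L' = l"
      using step L by (simp_all add: step_ok_def)
    fix x assume x: "x \<in> open_ends L' F'"
    then have "x \<in> {2..Suc t}" using open_ends_subset[OF sys'(1)] by blast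
    then consider "x \<le> t" | "x = Suc t" by fastforce
    then show "card (right_nbs (Suc t) x) + potential L' F' x \<le> card (missing x) + l"
    proof cases
      case 1
      have "right_nbs (Suc t) x = right_nbs t x \<union> (if A x (Suc t) then {Suc t} else {})"
        using 1 by (auto simp: right_nbs_def le_Suc_eq)
      then have "card (right_nbs (Suc t) x) \<le> card (right_nbs t x) + of_bool (A x (Suc t))"
        using card_Un_le[of "right_nbs t x" "{Suc t}"] by (auto split: if_splits)
      moreover have "x \<in> open_ends L F"
        "of_bool (A x (Suc t)) + potential L' F' x \<le> potential L F x"
        using step x 1 unfolding step_ok_def by blast+
      ultimately show ?thesis using inv[of x] by linarith
    next
      case 2
      then show ?thesis using new x by (simp add: right_nbs_def)
    qed
  qed
  then show ?thesis by blast
qed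

lemma good_state_exists:
  assumes "l + 1 \<le> t" "t \<le> n - 1"
  shows "\<exists>L F. good_state t L F"
  using assms
proof (induction t rule: dec_induct)
  case base
  then show ?case using good_state_init by blast
next
  case (step t)
  then obtain L F where "good_state t L F" by fastforce
  then show ?case using good_state_step[of t L F] step by simp
qed

text \<open>The larger end of a free path has weight 2 from that path, also for a singleton, and
  \<open>l - 1\<close> from the legs. A potential of \<open>l + 1\<close> exceeds what the budget
  leaves at time \<open>n - 1\<close>.\<close>

lemma good_state_end_no_free:
  assumes "good_state (n - 1) L F"
  shows "F = {#}"
proof (rule ccontr)
  assume "F \<noteq> {#}"
  then obtain q F' where F: "F = add_mset q F'" by (meson multiset_cases)
  define x where "x = max (hd q) (last q)"
  have sys: "partial_system A (n - 1) L F" and L: "size L = l"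
    using assms by (simp_all add: good_state_def)
  have x: "x \<in> open_ends L F" by (simp add: x_def F open_ends_def max_def)
  have "x \<notin> last ` set_mset L"
  proof
    assume "x \<in> last ` set_mset L"
    then have "x \<in> open_ends L F'" by (simp add: open_ends_def)
    moreover have "q \<noteq> []" using partial_system_set_subset[OF sys] F by auto
    then have "x \<in> set q" by (simp add: x_def max_def)
    ultimately show False using partial_system_free_disjoint sys unfolding F by blast
  qed
  moreover have "free_weight x q \<ge> 2" by (auto simp: free_weight_def x_def max_def)
  ultimately have "potential L F x \<ge> l + 1" using L l_pos by (simp add: F potential_def leg_weight_def)
  moreover have "x \<in> {1..n - 1}" using open_ends_subset[OF sys] x by fastforce
  then have "card (missing x) \<le> card (right_nbs (n - 1) x)" by (rule missing_le_right_nbs_end)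
  moreover have "card (right_nbs (n - 1) x) + potential L F x \<le> card (missing x) + l"
    using assms x unfolding good_state_def by blast
  ultimately show False by linarith
qed

theorem spanning_legs:
  "\<exists>ps. length ps = l \<and> distinct (concat ps) \<and> set (concat ps) = {2..n - 1} \<and>
     (\<forall>p\<in>set ps. p \<noteq> [] \<and> successively A (1 # p @ [n]))"
proof -
  have "l + 1 \<le> n - 1" using n_ge by linarith
  then obtain L F where good: "good_state (n - 1) L F"
    using good_state_exists[of "n - 1"] by blast
  then have "F = {#}" by (rule good_state_end_no_free)
  with good have sys: "partial_system A (n - 1) L {#}" and L: "size L = l"
    unfolding good_state_def by simp_all
  obtain ps where ps: "mset ps = L" using ex_mset by blast
  have "mset (concat ps) = mset_set {2..n - 1}"
    using sys unfolding partial_system_def ps[symmetric] by (simp add: mset_concat sum_mset_sum_list flip: mset_map)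
  moreover have "mset (sorted_list_of_set {2..n - 1}) = mset_set {2..n - 1}"
    by (metis distinct_sorted_list_of_set finite_atLeastAtMost mset_set_set set_sorted_list_of_set)
  ultimately have "mset (concat ps) = mset (sorted_list_of_set {2..n - 1})" by simp
  then have "distinct (concat ps)" "set (concat ps) = {2..n - 1}"
    using mset_eq_imp_distinct_iff mset_eq_setD by (metis distinct_sorted_list_of_set,
      metis finite_atLeastAtMost set_sorted_list_of_set)
  moreover have "p \<noteq> [] \<and> successively A (1 # p @ [n])" if "p \<in> set ps" for p
  proof -
    have p: "p \<in># L" using that ps by auto
    then have 1: "p \<noteq> []" "successively A p" "A 1 (hd p)"
      using sys by (auto simp: partial_system_def)
    \<comment> \<open>Leg ends are recent at time \<open>n - 1\<close>, hence within distance
      \<open>k\<close> of \<open>n\<close>, and \<open>n\<close> is adjacent to all such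
      vertices.\<close>
    have "last p \<in> open_ends L F" using p by (simp add: open_ends_def)
    then have "n - 1 < last p + k" "last p \<in> {2..n - 1}"
      using good_state_recent[OF good] open_ends_subset[OF sys] \<open>F = {#}\<close> by auto
    then have "A (last p) n" by (intro last_adjacent) auto
    then show ?thesis using 1 by (auto simp: successively_Cons successively_append_iff)
  qed
  ultimately show ?thesis using L ps by (metis size_mset)
qed

end

section \<open>Transfer from indices to the labelled graph\<close>

lemma set_vwalk_arcs_map_subset:
  "successively (\<lambda>i j. (f i, f j) \<in> E) xs \<Longrightarrow> set (vwalk_arcs (map f xs)) \<subseteq> E"
  by (induction xs rule: induct_list012) auto

text \<open>Distinctness of the concatenation tolerates repeated empty lists; nonemptiness makes the
  lists themselves distinct.\<close>

lemma disjoint_if_distinct_concat: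
  assumes "distinct (concat ps)" "i < length ps" "j < length ps" "i \<noteq> j"
    and "\<forall>p\<in>set ps. p \<noteq> []"
  shows "set (ps ! i) \<inter> set (ps ! j) = {}"
proof -
  have "distinct ps" using assms(1,5) by (metis distinct_concat_iff removeAll_id)
  then have "ps ! i \<noteq> ps ! j" using assms(2-4) by (simp add: nth_eq_iff_index_eq)
  then show ?thesis using assms(1-3) by (meson distinct_concat_iff nth_mem)
qed

theorem theorem3:
  fixes n k l :: nat
    and G :: "'a pair_pre_digraph"
    and v :: "nat \<Rightarrow> 'a"
  assumes "k \<ge> l" and "l \<ge> 1" and "n \<ge> l + 2"
    and "pair_graph G"
    and "card (pverts G) = n"
    and labelling: "bij_betw v {1..n} (pverts G)"
    and bandwidth: "\<forall>i\<in>{1..n}. \<forall>j\<in>{1..n}.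
           (v i, v j) \<in> parcs G \<longrightarrow> \<bar>int i - int j\<bar> \<le> int k"
    and degree: "\<forall>i\<in>{1..n}.
           out_degree (with_proj G) (v i) \<ge> min (k + l) (min (i - 1) k + min (n - i) k)"
  shows "has_spanning_K2_subdivision G l (v 1) (v n) \<and>
         has_spanning_path_system G l (v 1) (v n)"
proof -
  interpret pair_graph G by fact
  \<comment> \<open>The relation is defined for all naturals, although \<open>v\<close> is
    controlled only on \<open>{1..n}\<close>; symmetry and irreflexivity hold everywhere, the other
    conditions on that range.\<close>
  define A where "A i j \<longleftrightarrow> (v i, v j) \<in> parcs G" for i j
  have inj: "inj_on v {1..n}" and img: "v ` {1..n} = pverts G"
    using labelling by (simp_all add: bij_betw_def)
  have out: "out_degree (with_proj G) (v i) = card {j \<in> {1..n}. A i j}" if i: "i \<in> {1..n}" for i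
  proof -
    have "out_arcs (with_proj G) (v i) = {e \<in> parcs G. fst e = v i}"
      by (simp add: out_arcs_def)
    also have "\<dots> = (\<lambda>j. (v i, v j)) ` {j \<in> {1..n}. A i j}" (is "?L = ?R")
    proof
      show "?L \<subseteq> ?R"
      proof
        fix e assume e: "e \<in> ?L"
        then have "e = (v i, snd e)" by (metis (mono_tags, lifting) mem_Collect_eq prod.collapse)
        moreover from e have "snd e \<in> v ` {1..n}" unfolding img using in_arcsD2[of "fst e" "snd e"] by simp
        ultimately show "e \<in> ?R" using e unfolding A_def by fastforce
      qed
    qed (auto simp: A_def)
    finally have "out_arcs (with_proj G) (v i) = (\<lambda>j. (v i, v j)) ` {j \<in> {1..n}. A i j}" .
    moreover have "inj_on (\<lambda>j. (v i, v j)) {j \<in> {1..n}. A i j}"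
      by (rule inj_onI, rule inj_onD[OF inj]) auto
    ultimately show ?thesis by (simp add: out_degree_def card_image)
  qed
  interpret bandwidth_graph A n k l
  proof
    show "symp A" using sym_arcs by (auto simp: A_def symp_def symmetric_def sym_def)
    show "\<not> A i i" for i using no_loops[of "(v i, v i)"] by (auto simp: A_def)
    show "i \<le> j + k" if "i \<in> {1..n}" "j \<in> {1..n}" "A i j" for i j
      using bandwidth that unfolding A_def by fastforce
    show "min (k + l) (min (i - 1) k + min (n - i) k) \<le> card {j \<in> {1..n}. A i j}"
      if "i \<in> {1..n}" for i
      using bspec[OF degree that] unfolding out[OF that] .
  qed (use assms in simp_all)
  obtain ps where ps: "length ps = l" "distinct (concat ps)" "set (concat ps) = {2..n - 1}"
    and p: "\<And>p. p \<in> set ps \<Longrightarrow> p \<noteq> [] \<and> successively A (1 # p @ [n])"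
    using spanning_legs by blast
  have sub: "set (ps ! i) \<subseteq> {2..n - 1}" if "i < l" for i
    using nth_mem[of i ps] that ps(1,3) by auto
  have sub': "set (ps ! i) \<subseteq> {1..n}" if "i < l" for i
    by (rule order_trans[OF sub[OF that]]) auto
  have v1n: "v 1 \<noteq> v n" using inj n_ge by (auto dest: inj_onD)
  define P where "P i = map v (1 # ps ! i @ [n])" for i
  have setP: "set (P i) = {v 1, v n} \<union> v ` set (ps ! i)" for i by (auto simp: P_def)
  have "has_spanning_path_system G l (v 1) (v n)"
    unfolding has_spanning_path_system_def
  proof (intro exI[of _ P] conjI allI impI)
    fix i assume i: "i < l"
    then have pi: "ps ! i \<in> set ps" using ps(1) by simp
    have inn: "set (1 # ps ! i @ [n]) \<subseteq> {1..n}" using sub'[OF i] n_ge by simp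
    have "distinct (ps ! i)" using ps(2) pi by (simp add: distinct_concat_iff)
    moreover have "1 \<notin> set (ps ! i)" "n \<notin> set (ps ! i)" "1 \<noteq> n"
      using subsetD[OF sub[OF i], of 1] subsetD[OF sub[OF i], of n] n_ge by auto
    ultimately have "distinct (1 # ps ! i @ [n])" by simp
    then have "distinct (P i)"
      unfolding P_def using inj_on_subset[OF inj inn] by (simp only: distinct_map)
    moreover have "set (P i) \<subseteq> pverts G" unfolding P_def img[symmetric] using inn by auto
    moreover have "set (vwalk_arcs (P i)) \<subseteq> parcs G"
      unfolding P_def using p[OF pi] by (intro set_vwalk_arcs_map_subset) (simp add: A_def)
    ultimately show "vpath (P i) (with_proj G)"
      by (auto simp: vpath_def vwalk_def P_def simp del: vwalk_arcs.simps)
    show "hd (P i) = v 1" "last (P i) = v n" by (simp_all add: P_def)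
    show "2 \<le> vwalk_length (P i)" using p[OF pi] by (cases "ps ! i") (auto simp: P_def)
  next
    fix i j assume ij: "i < l" "j < l" "i \<noteq> j"
    then have "set (ps ! i) \<inter> set (ps ! j) = {}"
      using disjoint_if_distinct_concat[OF ps(2)] ps(1) p by blast
    moreover note sub'[OF ij(1)] sub'[OF ij(2)]
    ultimately have "v ` set (ps ! i) \<inter> v ` set (ps ! j) = {}"
      using inj_on_image_Int[OF inj, of "set (ps ! i)" "set (ps ! j)"] by auto
    then show "set (P i) \<inter> set (P j) \<subseteq> {v 1, v n}" unfolding setP by auto
  next
    have "set ps = (!) ps ` {..<l}"
      using nth_image[of l ps] ps(1) by (simp add: atLeast0LessThan)
    then have "(\<Union>i<l. set (ps ! i)) = {2..n - 1}" using ps(3) by simp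
    \<comment> \<open>With no path at all, the union would not contain the roots \<open>v 1\<close>
      and \<open>v n\<close>.\<close>
    moreover have "{..<l} \<noteq> {}" using l_pos by (auto simp: lessThan_empty_iff)
    then have "(\<Union>i<l. set (P i)) = {v 1, v n} \<union> v ` (\<Union>i<l. set (ps ! i))"
      unfolding setP by blast
    ultimately have "(\<Union>i<l. set (P i)) = {v 1, v n} \<union> v ` {2..n - 1}" by simp
    also have "\<dots> = v ` ({1, n} \<union> {2..n - 1})" by auto
    also have "{1, n} \<union> {2..n - 1} = {1..n}" using n_ge by auto
    finally show "(\<Union>i<l. set (P i)) = pverts G" unfolding img .
  qed
  then show ?thesis
    using has_spanning_K2_subdivision_if_path_system[OF assms(4) l_pos v1n] by blast
qed

end
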